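(* Let $p$ be a prime, $q=p^s$, $e>0$, $a>0$ integers, and $n=(q-1)q^0+(q-1)q^e+q^a$. Then, as polynomials, $g_{n,q}=-x-S_a+\mathrm{Tr}_{q^e/q}(x)-S_a\,\mathrm{Tr}_{q^e/q}(x)^{q-1}$. Assume that (i) $-2a-1+e\not\equiv 0\pmod p$; (ii) $\gcd(x^a+x-2,\ x^e-1)=x-1$ in $\mathbb{F}_p[x]$; (iii) $\gcd(2x^a+x-3,\ x^e-1)=x-1$ in $\mathbb{F}_p[x]$. Then $g_{n,q}$ is a permutation polynomial of $\mathbb{F}_{q^e}$.
   Context: For a prime $p$, a power $q$ of $p$ and an integer $n\ge 0$, $g_{n,q}\in\mathbb{F}_p[x]$ is the unique polynomial with $\sum_{a\in\mathbb{F}_q}(x+a)^n=g_{n,q}(x^q-x)$. A permutation polynomial of a finite field $\mathbb{F}$ is a polynomial inducing a bijection of $\mathbb{F}$. For an integer $a\ge 0$, $S_a=x+x^q+\cdots+x^{q^{a-1}}$, and $\mathrm{Tr}_{q^e/q}(x)=x+x^q+\cdots+x^{q^{e-1}}$, regarded as a polynomial.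
   Formalization: The polynomial identity for g_{n,q} is stated only for q ≠ 2, because for q = 2 it always fails (g_{n,2} has constant term 1, the formula 0); the permutation claim covers all q, including q = 2. *)

theory Defs
  imports "Berlekamp_Zassenhaus.Finite_Field"
begin

text \<open>
  \<open>\<bbbF>\<^sub>p\<close> is \<^typ>\<open>'p mod_ring\<close> with \<open>CARD('p) = p\<close>; the fields \<open>\<bbbF>\<^sub>q\<close> and \<open>\<bbbF>\<^sub>q\<^sub>^\<^sub>e\<close> are types of class
  \<^class>\<open>finite_field\<close> of the respective cardinality. The following map is the
  embedding of \<open>\<bbbF>\<^sub>p\<close> into a field of characteristic \<open>p\<close> (cf. \<open>prime_field_emb_hom\<close> below);
  in any other field it is meaningless.
\<close>

definition prime_field_emb :: "'p::prime_card mod_ring \<Rightarrow> 'a::field" where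
  "prime_field_emb c = of_int (to_int_mod_ring c)"

definition base_change :: "'p::prime_card mod_ring poly \<Rightarrow> 'a::field poly" where
  "base_change f = map_poly prime_field_emb f"

text \<open>
  The polynomial \<open>g\<^bsub>n,q\<^esub>\<close>, where \<open>q = CARD('q)\<close>; the defining identity is one in \<open>\<bbbF>\<^sub>q[x]\<close>.
\<close>

definition is_g_poly :: "'q::finite_field itself \<Rightarrow> nat \<Rightarrow> 'p::prime_card mod_ring poly \<Rightarrow> bool" where
  "is_g_poly _ n g \<longleftrightarrow>
     (\<Sum>a\<in>(UNIV :: 'q set). [:a, 1:] ^ n) =
       pcompose (base_change g) (monom 1 CARD('q) - monom 1 1)"

definition g_poly :: "'q::finite_field itself \<Rightarrow> nat \<Rightarrow> 'p::prime_card mod_ring poly" where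
  "g_poly F n = (THE g. is_g_poly F n g)"

definition S_poly :: "nat \<Rightarrow> nat \<Rightarrow> 'a::comm_ring_1 poly" where
  "S_poly q a = (\<Sum>i<a. monom 1 (q ^ i))"

definition Tr_poly :: "nat \<Rightarrow> nat \<Rightarrow> 'a::comm_ring_1 poly" where
  "Tr_poly q e = (\<Sum>i<e. monom 1 (q ^ i))"

definition permutation_poly :: "'a::finite_field poly \<Rightarrow> bool" where
  "permutation_poly f \<longleftrightarrow> bij (poly f)"


lemma CHAR_eq_of_CARD:
  assumes "CARD('a::finite_field) = CARD('p::prime_card) ^ s"
  shows "CHAR('a) = CARD('p)"
proof -
  have "CHAR('a) dvd CARD('p) ^ s"
    using CHAR_dvd_CARD[where ?'a = 'a] assms by simp
  moreover have "prime CHAR('a)" by simp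
  ultimately show ?thesis
    using prime_card[where ?'a = 'p] prime_dvd_power primes_dvd_imp_eq by blast
qed

lemma prime_field_emb_hom:
  assumes "CHAR('a::field) = CARD('p::prime_card)"
  shows "field_hom (prime_field_emb :: 'p mod_ring \<Rightarrow> 'a)"
proof
  show "prime_field_emb (0 :: 'p mod_ring) = (0 :: 'a)"
    by (simp add: prime_field_emb_def)
  show "prime_field_emb (1 :: 'p mod_ring) = (1 :: 'a)"
    by (simp add: prime_field_emb_def)
  fix x y :: "'p mod_ring"
  show "prime_field_emb (x + y) = (prime_field_emb x + prime_field_emb y :: 'a)"
    by (simp add: prime_field_emb_def to_int_mod_ring_add flip: assms)
  show "prime_field_emb (x * y) = (prime_field_emb x * prime_field_emb y :: 'a)"
    by (simp add: prime_field_emb_def to_int_mod_ring_mult flip: assms)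
qed

lemma range_prime_field_emb:
  assumes CHAR: "CHAR('a::finite_field) = CARD('p::prime_card)"
    and x: "x ^ CARD('p) = (x :: 'a)"
  shows "x \<in> range (prime_field_emb :: 'p mod_ring \<Rightarrow> 'a)"
proof -
  interpret field_hom "prime_field_emb :: 'p mod_ring \<Rightarrow> 'a"
    by (rule prime_field_emb_hom[OF CHAR])
  define P :: "'a poly" where "P = monom 1 CARD('p) - monom 1 1"
  have gt: "CARD('p) > 1"
    using prime_card[where ?'a = 'p] prime_gt_1_nat by blast
  have P0: "P \<noteq> 0"
  proof
    assume "P = 0"
    hence "coeff P CARD('p) = 0" by simp
    thus False using gt by (simp add: P_def)
  qed
  have "degree P \<le> CARD('p)"
    unfolding P_def using gt by (intro degree_diff_le) (auto simp: degree_monom_eq)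
  hence card: "card {z. poly P z = 0} \<le> CARD('p)"
    using card_poly_roots_bound[OF P0] by linarith
  have "range (prime_field_emb :: 'p mod_ring \<Rightarrow> 'a) \<subseteq> {z. poly P z = 0}"
  proof safe
    fix c :: "'p mod_ring"
    have "c ^ CARD('p) = c"
      using finite_field_power_card_eq_same[of c] by simp
    hence "(prime_field_emb c :: 'a) ^ CARD('p) = prime_field_emb c"
      by (simp flip: hom_power)
    thus "poly P (prime_field_emb c) = 0"
      by (simp add: P_def poly_monom)
  qed
  moreover have "card (range (prime_field_emb :: 'p mod_ring \<Rightarrow> 'a)) = CARD('p)"
    using card_image[OF inj_f] by simp
  ultimately have "range (prime_field_emb :: 'p mod_ring \<Rightarrow> 'a) = {z. poly P z = 0}"
    using card poly_roots_finite[OF P0] by (intro card_seteq) auto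
  thus ?thesis using x by (simp add: P_def poly_monom)
qed

lemma sum_power_finite_field_in_range:
  assumes CHAR: "CHAR('q::finite_field) = CARD('p::prime_card)"
  shows "(\<Sum>a\<in>(UNIV::'q set). a ^ n) \<in> range (prime_field_emb :: 'p mod_ring \<Rightarrow> 'q)"
proof (rule range_prime_field_emb[OF CHAR])
  let ?p = "CHAR('q)"
  have inj: "inj (\<lambda>a::'q. a ^ ?p)"
  proof
    fix a b :: 'q assume *: "a ^ ?p = b ^ ?p"
    have "a ^ ?p = ((a - b) + b) ^ ?p" by simp
    also have "\<dots> = (a - b) ^ ?p + b ^ ?p"
      by (rule freshmans_dream) auto
    finally show "a = b" using * by simp
  qed
  have bij: "bij (\<lambda>a::'q. a ^ ?p)"
    using inj finite_UNIV_inj_surj[OF _ inj] by (auto simp: bij_def)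
  have "(\<Sum>a\<in>(UNIV::'q set). a ^ n) ^ ?p = (\<Sum>a\<in>UNIV. (a ^ n) ^ ?p)"
    by (rule freshmans_dream_sum) auto
  also have "\<dots> = (\<Sum>a\<in>UNIV. (a ^ ?p) ^ n)"
    by (simp add: mult.commute flip: power_mult)
  also have "\<dots> = (\<Sum>a\<in>UNIV. a ^ n)"
    by (rule sum.reindex_bij_betw[OF bij])
  finally show "(\<Sum>a\<in>(UNIV::'q set). a ^ n) ^ CARD('p) = (\<Sum>a\<in>UNIV. a ^ n)"
    by (simp add: CHAR)
qed

lemma is_g_poly_exists:
  assumes Q: "CARD('q::finite_field) = CARD('p::prime_card) ^ s"
  shows "\<exists>g :: 'p mod_ring poly. is_g_poly TYPE('q) n g"
proof (induction n rule: less_induct)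
  case (less n)
  note CHAR = CHAR_eq_of_CARD[OF Q]
  interpret E: field_hom "prime_field_emb :: 'p mod_ring \<Rightarrow> 'q"
    by (rule prime_field_emb_hom[OF CHAR])
  interpret M: map_poly_inj_idom_hom "prime_field_emb :: 'p mod_ring \<Rightarrow> 'q" ..
  define q where "q = CARD('q)"
  let ?y = "monom 1 q - monom 1 1 :: 'q poly"
  let ?s = "\<lambda>n. (\<Sum>a\<in>(UNIV :: 'q set). [:a, 1:] ^ n)"
  have q: "q > 1"
    unfolding q_def using card_mono[of UNIV "{0, 1 :: 'q}"] by simp
  show ?case
  proof (cases "n < q")
    case True
    obtain c :: "'p mod_ring" where c: "(\<Sum>a\<in>(UNIV::'q set). a ^ n) = prime_field_emb c"
      using sum_power_finite_field_in_range[OF CHAR, of n] by auto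
    have "?s n = [:prime_field_emb c:]"
    proof (rule poly_eqI_degree[of "UNIV :: 'q set"])
      fix x :: 'q
      have "poly (?s n) x = (\<Sum>a\<in>UNIV. (a + x) ^ n)"
        by (simp add: poly_sum)
      also have "\<dots> = (\<Sum>a\<in>UNIV. a ^ n)"
        by (rule sum.reindex_bij_witness[of _ "\<lambda>a. a - x" "\<lambda>a. a + x"]) auto
      finally show "poly (?s n) x = poly [:prime_field_emb c:] x"
        by (simp add: c)
    next
      have "degree (?s n) \<le> n"
        by (intro degree_sum_le) (auto intro: order.trans[OF degree_power_le])
      thus "degree (?s n) < card (UNIV :: 'q set)"
        using True by (simp add: q_def)
    qed (use q in \<open>auto simp: q_def\<close>)
    thus ?thesis
      by (intro exI[of _ "[:c:]"]) (simp add: is_g_poly_def base_change_def hom_distribs)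
  next
    case False
    have lt: "n - q + 1 < n" "n - q < n"
      using False q by linarith+
    obtain g1 :: "'p mod_ring poly" where g1: "is_g_poly TYPE('q) (n - q + 1) g1"
      using less.IH[OF lt(1)] by blast
    obtain g0 :: "'p mod_ring poly" where g0: "is_g_poly TYPE('q) (n - q) g0"
      using less.IH[OF lt(2)] by blast
    have step: "[:a, 1:] ^ n = [:a, 1:] ^ (n - q + 1) + ?y * [:a, 1:] ^ (n - q)" for a :: 'q
    proof -
      have k: "q = CHAR('q) ^ s"
        by (simp add: q_def Q CHAR)
      have lin: "[:a, 1:] = [:a:] + monom 1 1"
        by (simp add: monom_altdef)
      have "[:a, 1:] ^ q = [:a:] ^ q + monom 1 1 ^ q"
        unfolding lin by (rule freshmans_dream') (auto simp: k)
      also have "[:a:] ^ q = [:a:]"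
        by (simp add: q_def poly_const_pow finite_field_power_card_eq_same)
      also have "[:a:] + monom 1 1 ^ q = [:a, 1:] + ?y"
        unfolding lin monom_power by simp
      finally have pow: "[:a, 1:] ^ q = [:a, 1:] + ?y" .
      have "[:a, 1:] ^ n = [:a, 1:] ^ (n - q) * [:a, 1:] ^ q"
        using False by (subst power_add [symmetric]) simp
      also have "\<dots> = [:a, 1:] ^ (n - q) * [:a, 1:] + [:a, 1:] ^ (n - q) * ?y"
        unfolding pow by (rule distrib_left)
      also have "[:a, 1:] ^ (n - q) * [:a, 1:] = [:a, 1:] ^ (n - q + 1)"
        by (subst power_add, subst power_one_right) (rule refl)
      also have "[:a, 1:] ^ (n - q) * ?y = ?y * [:a, 1:] ^ (n - q)"
        by (rule mult.commute)
      finally show ?thesis .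
    qed
    have X: "pcompose (monom 1 1) ?y = ?y"
      by (simp add: monom_altdef pcompose_pCons)
    have "?s n = ?s (n - q + 1) + ?y * ?s (n - q)"
      unfolding step sum.distrib sum_distrib_left by (rule refl)
    also have "\<dots> = pcompose (base_change g1) ?y + ?y * pcompose (base_change g0) ?y"
      using g1 g0 unfolding is_g_poly_def q_def
      by (intro arg_cong2[where f = plus] arg_cong2[where f = times] refl)
    also have "\<dots> = pcompose (base_change g1 + monom 1 1 * base_change g0) ?y"
      by (simp only: pcompose_add pcompose_mult X)
    also have "base_change g1 + monom 1 1 * base_change g0 =
                 (base_change (g1 + monom 1 1 * g0) :: 'q poly)"
      by (simp only: base_change_def M.hom_add M.hom_mult E.map_poly_hom_monom E.hom_one)
    finally show ?thesis
      unfolding is_g_poly_def q_def by blast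
  qed
qed

lemma is_g_poly_unique:
  assumes CHAR: "CHAR('q::finite_field) = CARD('p::prime_card)"
    and "is_g_poly TYPE('q) n (g :: 'p mod_ring poly)" "is_g_poly TYPE('q) n h"
  shows "g = h"
proof -
  interpret E: field_hom "prime_field_emb :: 'p mod_ring \<Rightarrow> 'q"
    by (rule prime_field_emb_hom[OF CHAR])
  interpret M: map_poly_inj_idom_hom "prime_field_emb :: 'p mod_ring \<Rightarrow> 'q" ..
  let ?y = "monom 1 CARD('q) - monom 1 1 :: 'q poly"
  have q: "CARD('q) > 1"
    using card_mono[of UNIV "{0, 1 :: 'q}"] by simp
  have "coeff ?y CARD('q) = 1" using q by simp
  hence "degree ?y \<ge> CARD('q)" by (intro le_degree) simp
  hence deg: "degree ?y > 0" using q by linarith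
  have "pcompose (base_change g - base_change h) ?y = 0"
    using assms(2,3) by (simp add: is_g_poly_def pcompose_diff)
  hence "base_change g - base_change h = (0 :: 'q poly)"
    using deg by (rule pcompose_eq_0)
  thus ?thesis by (simp add: base_change_def)
qed

text \<open>\<open>g\<^bsub>n,q\<^esub>\<close> is well defined whenever \<open>q\<close> is a power of \<open>p\<close>.\<close>

lemma is_g_poly_g_poly:
  assumes "CARD('q::finite_field) = CARD('p::prime_card) ^ s"
  shows "is_g_poly TYPE('q) n (g_poly TYPE('q) n :: 'p mod_ring poly)"
  unfolding g_poly_def
proof (rule theI')
  show "\<exists>!g. is_g_poly TYPE('q) n (g :: 'p mod_ring poly)"
    using is_g_poly_exists[OF assms, of n] is_g_poly_unique[OF CHAR_eq_of_CARD[OF assms]] by blast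
qed

text \<open>
  For \<open>q = 2\<close> the polynomial \<open>g\<^bsub>n,q\<^esub>\<close> has constant term \<open>\<Sum>a\<in>\<bbbF>\<^sub>2. a\<^sup>n = 1\<close> for all \<open>n > 0\<close>, whereas
  \<open>- x - S\<^sub>a + Tr - S\<^sub>a Tr\<^sup>q\<^sup>-\<^sup>1\<close> has constant term \<open>0\<close>. The closed form in the theorem is
  therefore only claimed for \<open>q \<noteq> 2\<close>.
\<close>

lemma g_poly_closed_form_fails_2:
  assumes q: "CARD('q::finite_field) = 2" and p: "CARD('p::prime_card) = 2" and n: "n > 0"
  shows "(g_poly TYPE('q) n :: 'p mod_ring poly) \<noteq>
           - monom 1 1 - S_poly 2 a + Tr_poly 2 e - S_poly 2 a * Tr_poly 2 e ^ (2 - 1)"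
    (is "_ \<noteq> ?h")
proof
  assume eq: "g_poly TYPE('q) n = ?h"
  have card: "CARD('q) = CARD('p) ^ 1" by (simp add: p q)
  interpret E: field_hom "prime_field_emb :: 'p mod_ring \<Rightarrow> 'q"
    by (rule prime_field_emb_hom[OF CHAR_eq_of_CARD[OF card]])
  have UNIV: "(UNIV :: 'q set) = {0, 1}"
    by (rule sym, rule card_subset_eq) (simp_all add: q)
  have "is_g_poly TYPE('q) n ?h"
    using is_g_poly_g_poly[OF card, of n] by (simp only: eq)
  hence "poly (\<Sum>a\<in>(UNIV :: 'q set). [:a, 1:] ^ n) 0 =
           poly (pcompose (base_change ?h) (monom 1 CARD('q) - monom 1 1)) 0"
    unfolding is_g_poly_def by (rule arg_cong)
  moreover have "poly (\<Sum>a\<in>(UNIV :: 'q set). [:a, 1:] ^ n) 0 = 1"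
    using n by (simp add: UNIV)
  moreover have "poly (pcompose (base_change ?h) (monom 1 CARD('q) - monom 1 1)) 0 = (0 :: 'q)"
  proof -
    have "poly (monom 1 CARD('q) - monom 1 1) (0 :: 'q) = 0"
      by (simp add: poly_monom q)
    hence "poly (pcompose (base_change ?h) (monom 1 CARD('q) - monom 1 1)) (0 :: 'q) =
             poly (base_change ?h) 0"
      by (simp only: poly_pcompose)
    also have "\<dots> = coeff (base_change ?h) 0"
      by (rule poly_0_coeff_0)
    also have "\<dots> = prime_field_emb (coeff ?h 0)"
      unfolding base_change_def by (rule coeff_map_poly) simp
    also have "coeff ?h 0 = 0"
      by (simp add: coeff_mult_0 coeff_sum S_poly_def Tr_poly_def)
    finally show ?thesis by simp
  qed
  ultimately show False by simp
qed

end

theory Submission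
  imports Defs
begin

text \<open>
  Put \<open>y = x\<^sup>q - x\<close>. For \<open>z = x + b\<close> with \<open>b\<close> in the field of \<open>q\<close> elements one has \<open>z\<^sup>q = z + y\<close>,
  so \<open>z\<close> raised to \<open>q\<^sup>i\<close> is \<open>z + S\<^sub>i(y)\<close> and the defining sum becomes the sum over \<open>z\<close> of
  \<open>z\<^sup>q\<^sup>-\<^sup>1 (z + T)\<^sup>q\<^sup>-\<^sup>1 (z + S)\<close> with \<open>T = S\<^sub>e(y)\<close>, \<open>S = S\<^sub>a(y)\<close>. It is expanded with the power sums
  over the \<open>z\<close>, which satisfy \<open>P(k + q) = P(k + 1) + y P(k)\<close>. For \<open>q = 2\<close> the result is the same
  up to the constant \<open>-1\<close>, which does not affect the permutation property.

  On the field with \<open>q\<^sup>e\<close> elements, \<open>Tr(x)\<close> lies in the subfield with \<open>q\<close> elements, so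
  \<open>Tr(x)\<^sup>q\<^sup>-\<^sup>1\<close> is \<open>0\<close> or \<open>1\<close>, and up to the constant the map is the additive map \<open>-x - S\<^sub>a(x)\<close> on the
  kernel of the trace and the additive map \<open>-x - 2 S\<^sub>a(x) + Tr(x)\<close> off it. The second multiplies
  traces by \<open>e - 2a - 1\<close>, hence the two images are disjoint and the trace is recovered from the
  value. Injectivity on each piece says that \<open>A(\<phi>) d = B(\<phi>) d = 0\<close> implies \<open>d = 0\<close>, where \<open>\<phi>\<close> is the
  \<open>q\<close>-Frobenius, \<open>B = (x\<^sup>e - 1) / (x - 1)\<close>, and \<open>A\<close> is \<open>(x\<^sup>a + x - 2) / (x - 1)\<close> or
  \<open>(2x\<^sup>a + x - 3) / (x - 1)\<close>; this holds since \<open>A\<close> and \<open>B\<close> are coprime by (ii) and (iii).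
\<close>

subsection \<open>Power sums\<close>

lemma CARD_finite_field_gt_1: "CARD('q::finite_field) > 1"
  using card_mono[of UNIV "{0, 1 :: 'q}"] by simp

text \<open>The polynomial x^k - 1 has at most \<open>k\<close> roots, fewer than there are nonzero
  field elements.\<close>

lemma ex_power_neq_1:
  assumes "0 < k" "k < CARD('q::finite_field) - 1"
  shows "\<exists>b::'q. b \<noteq> 0 \<and> b ^ k \<noteq> 1"
proof (rule ccontr)
  assume *: "\<not> ?thesis"
  let ?P = "monom 1 k - 1 :: 'q poly"
  have "coeff ?P k = 1" using assms by simp
  hence nz: "?P \<noteq> 0" by (metis coeff_0 zero_neq_one)
  have deg: "degree ?P \<le> k" by (intro degree_diff_le) (auto simp: degree_monom_eq)
  have "UNIV - {0} \<subseteq> {z. poly ?P z = 0}" using * by (auto simp: poly_monom)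
  hence "card (UNIV - {0 :: 'q}) \<le> card {z. poly ?P z = 0}"
    by (intro card_mono) auto
  also have "\<dots> \<le> k"
    using card_poly_roots_bound[OF nz] deg by linarith
  finally show False using assms by (simp add: card_Diff_singleton)
qed

text \<open>For the top exponent every nonzero term is 1, and their number is -1 in the field. For
  other positive \<open>k\<close>, scaling by some \<open>b\<close> with
  \<open>b ^ k \<noteq> 1\<close> multiplies the sum by \<open>b ^ k\<close>, so it
  vanishes.\<close>

lemma sum_power_finite_field:
  assumes "k < CARD('q::finite_field)"
  shows "(\<Sum>a\<in>(UNIV::'q set). a ^ k) = (if k = CARD('q) - 1 then -1 else 0)"
proof -
  have card0: "of_nat CARD('q) = (0 :: 'q)"
    using CHAR_dvd_CARD[where ?'a = 'q] by (simp add: of_nat_eq_0_iff_char_dvd)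
  show ?thesis
  proof (cases "k = CARD('q) - 1")
    case True
    have k: "k > 0" using True CARD_finite_field_gt_1[where ?'q = 'q] by simp
    have one: "a ^ k = 1" if "a \<noteq> 0" for a :: 'q
    proof -
      have "a * a ^ k = a * 1"
        using finite_field_power_card_eq_same[of a] True
        by (simp flip: power_Suc)
      thus ?thesis using that mult_left_cancel by blast
    qed
    have "(\<Sum>a\<in>(UNIV::'q set). a ^ k) = (\<Sum>a\<in>UNIV - {0}. a ^ k)"
      using k by (intro sum.mono_neutral_right) auto
    also have "\<dots> = (\<Sum>a\<in>UNIV - {0 :: 'q}. 1)"
      by (intro sum.cong) (auto simp: one)
    also have "\<dots> = of_nat (CARD('q) - 1)"
      by (simp add: card_Diff_singleton)
    also have "\<dots> = -1"
      using card0 CARD_finite_field_gt_1[where ?'q = 'q] by (subst of_nat_diff) auto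
    finally show ?thesis using True by simp
  next
    case False
    show ?thesis
    proof (cases "k = 0")
      \<comment> \<open>Since 0^0 = 1, the sum is the number of field elements, which is 0 in the
        field.\<close>
      case True
      thus ?thesis using False card0 by simp
    next
      case k: False
      have "0 < k" "k < CARD('q) - 1" using k False assms by auto
      then obtain b :: 'q where b: "b \<noteq> 0" "b ^ k \<noteq> 1"
        using ex_power_neq_1 by blast
      have "(\<Sum>a\<in>(UNIV::'q set). a ^ k) = (\<Sum>a\<in>UNIV. (b * a) ^ k)"
        by (rule sum.reindex_bij_witness[of _ "\<lambda>a. b * a" "\<lambda>a. a / b"]) (use b in auto)
      also have "\<dots> = b ^ k * (\<Sum>a\<in>UNIV. a ^ k)"
        by (simp add: power_mult_distrib sum_distrib_left)
      finally have "(b ^ k - 1) * (\<Sum>a\<in>(UNIV::'q set). a ^ k) = 0"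
        by (simp add: algebra_simps)
      thus ?thesis using b False by simp
    qed
  qed
qed

text \<open>The degree is below the field size, so values determine the sum; at each point a shift
  of \<open>a\<close> gives the power sum over the field.\<close>

lemma sum_linear_power:
  assumes "k < CARD('q::finite_field)"
  shows "(\<Sum>a\<in>(UNIV::'q set). [:a, 1:] ^ k) = (if k = CARD('q) - 1 then -1 else 0)"
proof (rule poly_eqI_degree[of "UNIV :: 'q set"])
  fix x :: 'q
  have "poly (\<Sum>a\<in>(UNIV::'q set). [:a, 1:] ^ k) x = (\<Sum>a\<in>UNIV. (a + x) ^ k)"
    by (simp add: poly_sum)
  also have "\<dots> = (\<Sum>a\<in>UNIV. a ^ k)"
    by (rule sum.reindex_bij_witness[of _ "\<lambda>a. a - x" "\<lambda>a. a + x"]) auto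
  finally show "poly (\<Sum>a\<in>(UNIV::'q set). [:a, 1:] ^ k) x =
      poly (if k = CARD('q) - 1 then -1 else 0) x"
    using sum_power_finite_field[OF assms] by simp
next
  have "degree (\<Sum>a\<in>(UNIV::'q set). [:a, 1:] ^ k) \<le> k"
    by (intro degree_sum_le) (auto intro: order.trans[OF degree_power_le])
  thus "degree (\<Sum>a\<in>(UNIV::'q set). [:a, 1:] ^ k) < card (UNIV :: 'q set)"
    using assms by simp
qed (use CARD_finite_field_gt_1[where ?'q = 'q] in auto)

lemma linear_power_CARD:
  fixes a :: "'q::finite_field"
  assumes s: "CARD('q) = CHAR('q) ^ s"
  shows "[:a, 1:] ^ CARD('q) = [:a, 1:] + (monom 1 CARD('q) - monom 1 1)"
proof -
  have lin: "[:a, 1:] = [:a:] + monom 1 1"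
    by (simp add: monom_altdef)
  have "[:a, 1:] ^ CARD('q) = [:a:] ^ CARD('q) + monom 1 1 ^ CARD('q)"
    unfolding lin by (rule freshmans_dream') (auto simp: s)
  also have "[:a:] ^ CARD('q) = [:a:]"
    by (simp add: poly_const_pow finite_field_power_card_eq_same)
  also have "[:a:] + monom 1 1 ^ CARD('q) = [:a, 1:] + (monom 1 CARD('q) - monom 1 1)"
    unfolding lin monom_power by simp
  finally show ?thesis .
qed

lemma power_CHAR_iterate:
  fixes z y :: "'a::comm_ring_1"
  assumes "prime CHAR('a)" "q = CHAR('a) ^ s" "z ^ q = z + y"
  shows "z ^ (q ^ i) = z + (\<Sum>j<i. y ^ (q ^ j))"
proof (induction i)
  case (Suc i)
  have "z ^ (q ^ Suc i) = (z ^ (q ^ i)) ^ q"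
    by (simp add: mult.commute flip: power_mult)
  also have "\<dots> = z ^ q + (\<Sum>j<i. y ^ (q ^ j)) ^ q"
    unfolding Suc.IH by (rule freshmans_dream'[OF assms(1,2)])
  also have "(\<Sum>j<i. y ^ (q ^ j)) ^ q = (\<Sum>j<i. (y ^ (q ^ j)) ^ q)"
    by (rule freshmans_dream_sum'[OF assms(1,2)])
  also have "\<dots> = (\<Sum>j<i. y ^ (q ^ Suc j))"
    by (simp add: mult.commute flip: power_mult)
  also have "z ^ q + \<dots> = z + (\<Sum>j<Suc i. y ^ (q ^ j))"
    by (subst sum.lessThan_Suc_shift) (simp add: assms(3) add.assoc)
  finally show ?case .
qed auto

text \<open>Expanding (z + T)^(q-1) with z = \<open>[:a, 1:]\<close> leaves power sums with
  exponents q-1 to 2q-1. By the recursion only those at q-1, 2q-2 and 2q-1 can be nonzero.\<close>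

lemma sum_shifted_product:
  fixes T S :: "'q::finite_field poly"
  defines "q \<equiv> CARD('q)"
  defines "y \<equiv> monom 1 q - monom 1 1 :: 'q poly"
  assumes s: "CARD('q) = CHAR('q) ^ s"
  shows "(\<Sum>a\<in>UNIV. [:a, 1:] ^ (q - 1) * ([:a, 1:] + T) ^ (q - 1) * ([:a, 1:] + S)) =
           - y - S + T - S * T ^ (q - 1) + (if q = 2 then -1 else 0)"
proof -
  define P where "P k = (\<Sum>a\<in>(UNIV::'q set). [:a, 1:] ^ k)" for k
  have q: "q > 1" unfolding q_def by (rule CARD_finite_field_gt_1)
  define k where "k = q - 2"
  have k: "q = Suc (Suc k)" using q by (simp add: k_def)
  have low: "P j = (if j = Suc k then -1 else 0)" if "j < q" for j
  proof -
    have "P j = (if j = q - 1 then -1 else 0)"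
      unfolding P_def q_def by (rule sum_linear_power) (use that q_def in simp)
    thus ?thesis using k by simp
  qed
  have step: "P (j + q) = P (j + 1) + y * P j" for j
  proof -
    have "[:a, 1:] ^ (j + q) = [:a, 1:] ^ (j + 1) + y * [:a, 1:] ^ j" for a :: 'q
    proof -
      have "[:a, 1:] ^ (j + q) = [:a, 1:] ^ j * ([:a, 1:] + y)"
        unfolding power_add q_def y_def linear_power_CARD[OF s] by (rule refl)
      thus ?thesis by (simp only: distrib_left power_add power_one_right mult.commute[of _ y])
    qed
    thus ?thesis unfolding P_def by (simp only: sum.distrib sum_distrib_left)
  qed
  have P1: "P (Suc k + i) = (if i = 0 \<or> i = Suc k then -1 else 0)" if "i \<le> Suc k" for i
  proof (cases i)
    case (Suc j)
    hence "P (Suc k + i) = P (j + q)" by (simp add: k add.commute)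
    also have "\<dots> = P (j + 1) + y * P j" by (rule step)
    also have "\<dots> = (if i = Suc k then -1 else 0)"
      using that Suc by (simp add: low k)
    finally show ?thesis using Suc by simp
  qed (simp add: low k)
  have P2: "P (Suc (Suc k + i)) =
      (if i = k then -1 else if i = Suc k then - y + (if q = 2 then -1 else 0) else 0)"
    if "i \<le> Suc k" for i
  proof -
    have eq: "P (Suc (Suc k + i)) = P (i + 1) + y * P i"
      using step[of i] by (simp add: k add.commute)
    show ?thesis
    proof (cases "i = Suc k")
      \<comment> \<open>Exponent 2q-1 needs the recursion twice and reaches \<open>P 1\<close>,
        which is -1 exactly for q = 2: the source of the extra constant.\<close>
      case True
      have "P (i + 1) = P (0 + q)" using True by (simp add: k)
      also have "\<dots> = P 1 + y * P 0" using step[of 0] by simp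
      also have "\<dots> = (if q = 2 then -1 else 0)" by (simp add: low k)
      finally have "P (i + 1) = (if q = 2 then -1 else 0)" .
      thus ?thesis unfolding eq using True by (simp add: low k)
    next
      case False
      thus ?thesis unfolding eq using that by (simp add: low k)
    qed
  qed
  define c where "c i = (of_nat (Suc k choose i) * T ^ (Suc k - i) :: 'q poly)" for i
  have c0: "c 0 = T ^ Suc k" and c1: "c (Suc k) = 1" by (simp_all add: c_def)
  \<comment> \<open>The binomial coefficient is q - 1, which equals -1 here.\<close>
  have ck: "c k = - T"
  proof -
    have "of_nat q = (0 :: 'q poly)"
      using CHAR_dvd_CARD[where ?'a = 'q] by (simp add: of_nat_eq_0_iff_char_dvd q_def)
    hence "of_nat (Suc k) = (-1 :: 'q poly)"
      by (simp add: k eq_neg_iff_add_eq_0 add.commute)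
    moreover have "c k = of_nat (Suc k) * T" unfolding c_def by (simp del: of_nat_Suc)
    ultimately show ?thesis by (simp only: mult_minus1)
  qed
  have "(\<Sum>a\<in>UNIV. [:a, 1:] ^ (q - 1) * ([:a, 1:] + T) ^ (q - 1) * ([:a, 1:] + S)) =
      (\<Sum>a\<in>UNIV. \<Sum>i\<le>Suc k. c i * ([:a, 1:] ^ Suc (Suc k + i) + S * [:a, 1:] ^ (Suc k + i)))"
  proof (rule sum.cong)
    fix a :: 'q
    define z where "z = [:a, 1:]"
    have "z ^ (q - 1) * (z + T) ^ (q - 1) * (z + S) =
        z ^ Suc k * (\<Sum>i\<le>Suc k. c i * z ^ i) * (z + S)"
      unfolding k c_def diff_Suc_1 binomial_ring
      by (simp only: mult_ac add.commute)
    also have "\<dots> = (\<Sum>i\<le>Suc k. z ^ Suc k * (c i * z ^ i) * (z + S))"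
      by (simp only: sum_distrib_left sum_distrib_right)
    also have "\<dots> = (\<Sum>i\<le>Suc k. c i * (z ^ Suc (Suc k + i) + S * z ^ (Suc k + i)))"
      by (intro sum.cong) (simp_all add: power_add algebra_simps)
    finally show "[:a, 1:] ^ (q - 1) * ([:a, 1:] + T) ^ (q - 1) * ([:a, 1:] + S) =
        (\<Sum>i\<le>Suc k. c i * ([:a, 1:] ^ Suc (Suc k + i) + S * [:a, 1:] ^ (Suc k + i)))"
      unfolding z_def .
  qed auto
  also have "\<dots> = (\<Sum>i\<le>Suc k. c i * (P (Suc (Suc k + i)) + S * P (Suc k + i)))"
    unfolding P_def by (subst sum.swap) (simp only: distrib_left sum.distrib sum_distrib_left)
  also have "\<dots> = (\<Sum>i\<le>Suc k. c i * P (Suc (Suc k + i))) + S * (\<Sum>i\<le>Suc k. c i * P (Suc k + i))"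
    by (simp only: distrib_left sum.distrib sum_distrib_left mult.left_commute)
  also have "(\<Sum>i\<le>Suc k. c i * P (Suc (Suc k + i))) =
      (\<Sum>i\<in>{k, Suc k}. c i * P (Suc (Suc k + i)))"
    by (intro sum.mono_neutral_right) (auto simp: P2 simp del: add_Suc)
  also have "\<dots> = T - y + (if q = 2 then -1 else 0)"
    by (simp add: P2 ck c1 del: add_Suc add_Suc_right)
  also have "(\<Sum>i\<le>Suc k. c i * P (Suc k + i)) = (\<Sum>i\<in>{0, Suc k}. c i * P (Suc k + i))"
    by (intro sum.mono_neutral_right) (auto simp: P1 simp del: add_Suc)
  also have "\<dots> = - (T ^ Suc k) - 1"
  proof -
    have "P (Suc k + 0) = -1" "P (Suc k + Suc k) = -1" 
      using P1[of 0] P1[of "Suc k"] by (simp_all del: add_Suc add_Suc_right)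
    thus ?thesis by (simp add: c0 c1 del: add_Suc add_Suc_right)
  qed
  finally show ?thesis by (simp add: k algebra_simps)
qed

subsection \<open>The closed form\<close>

lemma pcompose_monom_1: "pcompose (monom 1 i) p = p ^ i"
  by (induction i) (simp_all add: monom_0 monom_Suc pcompose_pCons one_pCons [symmetric])

lemma pcompose_power: "pcompose (r ^ i) p = pcompose r p ^ i"
  by (induction i) (simp_all add: pcompose_mult)

lemma pcompose_S_poly: "pcompose (S_poly q a) p = (\<Sum>i<a. p ^ (q ^ i))"
  by (simp add: S_poly_def pcompose_sum pcompose_monom_1)

lemma Tr_poly_eq_S_poly: "Tr_poly = S_poly"
  by (intro ext) (simp add: Tr_poly_def S_poly_def)

text \<open>The last summand is the correction for q = 2. The coefficient ring is left free, for use
  over the prime field and over both larger fields.\<close>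

definition closed_form :: "nat \<Rightarrow> nat \<Rightarrow> nat \<Rightarrow> 'a::comm_ring_1 poly" where
  "closed_form q e a =
     - monom 1 1 - S_poly q a + Tr_poly q e - S_poly q a * Tr_poly q e ^ (q - 1)
       + (if q = 2 then -1 else 0)"

lemma base_change_closed_form:
  assumes "CHAR('a::field) = CARD('p::prime_card)"
  shows "base_change (closed_form q e a :: 'p mod_ring poly) = (closed_form q e a :: 'a poly)"
proof -
  interpret E: field_hom "prime_field_emb :: 'p mod_ring \<Rightarrow> 'a"
    by (rule prime_field_emb_hom[OF assms])
  interpret M: map_poly_inj_idom_hom "prime_field_emb :: 'p mod_ring \<Rightarrow> 'a" ..
  have S: "map_poly prime_field_emb (S_poly q b :: 'p mod_ring poly) = (S_poly q b :: 'a poly)" for b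
    by (simp add: S_poly_def M.hom_sum E.map_poly_hom_monom)
  show ?thesis
    by (simp add: base_change_def closed_form_def Tr_poly_eq_S_poly M.hom_add M.hom_minus
        M.hom_uminus M.hom_mult M.hom_power E.map_poly_hom_monom S)
qed

theorem g_poly_eq_closed_form:
  assumes Q: "CARD('q::finite_field) = q" "q = CARD('p::prime_card) ^ s"
    and n: "n = (q - 1) * q ^ 0 + (q - 1) * q ^ e + q ^ a"
  shows "(g_poly TYPE('q) n :: 'p mod_ring poly) = closed_form q e a"
proof -
  have Q': "CARD('q) = CARD('p) ^ s" using Q by simp
  note CHAR = CHAR_eq_of_CARD[OF Q']
  let ?y = "monom 1 q - monom 1 1 :: 'q poly"
  have it: "[:b, 1:] ^ (q ^ i) = [:b, 1:] + (\<Sum>j<i. ?y ^ (q ^ j))" for b :: 'q and i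
    by (rule power_CHAR_iterate[where s = s])
      (use linear_power_CARD[where s = s and a = b] Q CHAR prime_card[where ?'a = 'p] in auto)
  have "[:b, 1:] ^ n = [:b, 1:] ^ (q - 1) * ([:b, 1:] + (\<Sum>j<e. ?y ^ (q ^ j))) ^ (q - 1) *
      ([:b, 1:] + (\<Sum>j<a. ?y ^ (q ^ j)))" for b :: 'q
  proof -
    \<comment> \<open>With \<open>q ^ e\<close> as the left factor, \<open>power_mult\<close>
      exposes the power rewritten by \<open>it\<close>.\<close>
    have "n = (q - 1) + q ^ e * (q - 1) + q ^ a" by (simp add: n)
    thus ?thesis by (simp only: power_add power_mult it)
  qed
  hence "(\<Sum>b\<in>(UNIV :: 'q set). [:b, 1:] ^ n) =
      - ?y - (\<Sum>j<a. ?y ^ (q ^ j)) + (\<Sum>j<e. ?y ^ (q ^ j))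
        - (\<Sum>j<a. ?y ^ (q ^ j)) * (\<Sum>j<e. ?y ^ (q ^ j)) ^ (q - 1) + (if q = 2 then -1 else 0)"
    using sum_shifted_product[where ?'q = 'q and s = s] Q CHAR by (simp only: Q(1))
  also have "\<dots> = pcompose (closed_form q e a) ?y"
    by (simp add: closed_form_def Tr_poly_eq_S_poly pcompose_add pcompose_diff pcompose_uminus
        pcompose_mult pcompose_power pcompose_S_poly pcompose_monom_1 pcompose_1)
  finally have "is_g_poly TYPE('q) n (closed_form q e a :: 'p mod_ring poly)"
    by (simp only: is_g_poly_def base_change_closed_form[OF CHAR] Q(1))
  thus ?thesis
    by (rule is_g_poly_unique[OF CHAR is_g_poly_g_poly[OF Q']])
qed

subsection \<open>Polynomials in the Frobenius map\<close>

text \<open>Horner form of P(\<phi>) d, where \<phi> is the map raising to the power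
  \<open>q\<close>.\<close>

definition frob_eval :: "nat \<Rightarrow> 'p::prime_card mod_ring poly \<Rightarrow> 'a::field \<Rightarrow> 'a" where
  "frob_eval q P d = fold_coeffs (\<lambda>c r. prime_field_emb c * d + r ^ q) P 0"

context
  fixes q s :: nat and d :: "'a::field"
  assumes CHAR: "CHAR('a) = CARD('p::prime_card)" and q: "q = CARD('p) ^ s"
begin

interpretation E: field_hom "prime_field_emb :: 'p mod_ring \<Rightarrow> 'a"
  by (rule prime_field_emb_hom[OF CHAR])

lemma frob_add: "(x + y :: 'a) ^ q = x ^ q + y ^ q"
  by (rule freshmans_dream'[where n = s]) (auto simp: CHAR q prime_card)

lemma frob_pos: "q > 0"
  using q prime_card[where ?'a = 'p] prime_gt_0_nat by auto

lemma frob_emb: "(prime_field_emb (c :: 'p mod_ring) :: 'a) ^ q = prime_field_emb c"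
  using finite_field_power_card_power_eq_same[where x = c and n = s] q by (simp flip: E.hom_power)

lemma frob_eval_0: "frob_eval q (0 :: 'p mod_ring poly) d = 0"
  by (simp add: frob_eval_def)

lemma frob_eval_pCons:
  "frob_eval q (pCons (c :: 'p mod_ring) P) d = prime_field_emb c * d + frob_eval q P d ^ q"
  using frob_pos by (cases "c = 0 \<and> P = 0") (auto simp: frob_eval_def)

lemma frob_eval_add:
  "frob_eval q (P + Q :: 'p mod_ring poly) d = frob_eval q P d + frob_eval q Q d"
  by (induction P Q rule: poly_induct2)
    (simp_all add: frob_eval_0 frob_eval_pCons frob_add E.hom_add algebra_simps)

lemma frob_eval_smult:
  "frob_eval q (smult (c :: 'p mod_ring) P) d = prime_field_emb c * frob_eval q P d"
  by (induction P)
    (simp_all add: frob_eval_0 frob_eval_pCons power_mult_distrib frob_emb E.hom_mult algebra_simps)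

text \<open>The polynomials annihilating \<open>d\<close> form an ideal, because \<phi> is additive
  and fixes the prime field.\<close>

lemma frob_eval_mult_eq_0:
  assumes "frob_eval q P d = 0"
  shows "frob_eval q (Q * P :: 'p mod_ring poly) d = 0"
  using frob_pos
  by (induction Q) (simp_all add: frob_eval_0 frob_eval_pCons frob_eval_add frob_eval_smult assms)

lemma frob_eval_monom: "frob_eval q (monom 1 i :: 'p mod_ring poly) d = d ^ (q ^ i)"
proof (induction i)
  case 0
  show ?case using frob_pos by (simp add: monom_0 frob_eval_pCons frob_eval_0)
next
  case (Suc i)
  thus ?case by (simp add: monom_Suc frob_eval_pCons mult.commute flip: power_mult)
qed

lemma frob_eval_1: "frob_eval q (1 :: 'p mod_ring poly) d = d"
  using frob_eval_monom[of 0] by (simp add: monom_0 one_pCons)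

lemma frob_eval_sum_monom:
  "frob_eval q (\<Sum>i<b. monom 1 i :: 'p mod_ring poly) d = (\<Sum>i<b. d ^ (q ^ i))"
  by (induction b) (simp_all add: frob_eval_0 frob_eval_add frob_eval_monom)

text \<open>Cancelling x - 1 in a Bezout identity shows that 1 lies in the ideal annihilating
  \<open>d\<close>.\<close>

lemma frob_eval_coprime:
  fixes A B :: "'p mod_ring poly"
  assumes gcd: "gcd ((monom 1 1 - 1) * A) ((monom 1 1 - 1) * B) = monom 1 1 - 1"
    and A: "frob_eval q A d = 0" and B: "frob_eval q B d = 0"
  shows "d = 0"
proof -
  let ?x = "monom 1 1 - 1 :: 'p mod_ring poly"
  have nz: "?x \<noteq> 0"
  proof
    assume "?x = 0"
    hence "coeff ?x 1 = 0" by simp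
    thus False by simp
  qed
  obtain u v where "u * (?x * A) + v * (?x * B) = ?x"
    using bezout_coefficients_fst_snd[of "?x * A" "?x * B"] unfolding gcd by blast
  hence "?x * (u * A + v * B) = ?x * 1" by (simp only: distrib_left mult.left_commute mult_1_right)
  hence "u * A + v * B = 1" using nz mult_left_cancel by blast
  thus ?thesis
    using frob_eval_add[of "u * A" "v * B"] frob_eval_mult_eq_0[OF A, of u]
      frob_eval_mult_eq_0[OF B, of v] frob_eval_1 by simp
qed

lemma monom_diff_1:
  "monom 1 b - 1 = (monom 1 1 - 1) * (\<Sum>i<b. monom 1 i :: 'p mod_ring poly)"
  using power_diff_1_eq[of "monom 1 1 :: 'p mod_ring poly" b] by (simp add: monom_power)

lemma frob_kernel_trivial:
  assumes "gcd (monom 1 a + monom 1 1 - 2) (monom 1 e - 1) = (monom 1 1 - 1 :: 'p mod_ring poly)"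
    and "d + (\<Sum>i<a. d ^ (q ^ i)) = 0" "(\<Sum>i<e. d ^ (q ^ i)) = 0"
  shows "d = 0"
proof (rule frob_eval_coprime)
  \<comment> \<open>In this splitting x - 1 divides both summands; the quotient acts on
    \<open>d\<close> as the map in the second assumption.\<close>
  have "monom 1 a + monom 1 1 - 2 = (monom 1 1 - 1) + (monom 1 a - 1 :: 'p mod_ring poly)"
    by simp
  also have "\<dots> = (monom 1 1 - 1) * (1 + (\<Sum>i<a. monom 1 i))"
    unfolding monom_diff_1[of a] by (simp add: algebra_simps)
  finally show "gcd ((monom 1 1 - 1) * (1 + (\<Sum>i<a. monom 1 i)))
      ((monom 1 1 - 1) * (\<Sum>i<e. monom 1 i)) = (monom 1 1 - 1 :: 'p mod_ring poly)"
    using assms(1) by (simp only: monom_diff_1[of e])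
qed (use assms in \<open>simp_all only: frob_eval_add frob_eval_1 frob_eval_sum_monom\<close>)

lemma frob_kernel_trivial_double:
  assumes "gcd (2 * monom 1 a + monom 1 1 - 3) (monom 1 e - 1) = (monom 1 1 - 1 :: 'p mod_ring poly)"
    and "d + (\<Sum>i<a. d ^ (q ^ i)) + (\<Sum>i<a. d ^ (q ^ i)) = 0" "(\<Sum>i<e. d ^ (q ^ i)) = 0"
  shows "d = 0"
proof (rule frob_eval_coprime)
  have "2 * monom 1 a + monom 1 1 - 3 =
      (monom 1 1 - 1) + (monom 1 a - 1) + (monom 1 a - 1 :: 'p mod_ring poly)"
    by simp
  also have "\<dots> = (monom 1 1 - 1) * (1 + (\<Sum>i<a. monom 1 i) + (\<Sum>i<a. monom 1 i))"
    unfolding monom_diff_1[of a] by (simp add: algebra_simps)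
  finally show "gcd ((monom 1 1 - 1) * (1 + (\<Sum>i<a. monom 1 i) + (\<Sum>i<a. monom 1 i)))
      ((monom 1 1 - 1) * (\<Sum>i<e. monom 1 i)) = (monom 1 1 - 1 :: 'p mod_ring poly)"
    using assms(1) by (simp only: monom_diff_1[of e])
qed (use assms in \<open>simp_all only: frob_eval_add frob_eval_1 frob_eval_sum_monom\<close>)

end

subsection \<open>The permutation property\<close>

lemma inj_trace_form:
  fixes q e a :: nat and c :: "'k::finite_field"
  defines "S \<equiv> \<lambda>b x. \<Sum>i<b. (x::'k) ^ (q ^ i)"
  assumes card: "CARD('k) = q ^ e" and q: "q = CHAR('k) ^ s" "q > 1"
    and nz: "of_int (- 2 * int a - 1 + int e) \<noteq> (0 :: 'k)"
    and ker1: "\<And>d. d + S a d = 0 \<Longrightarrow> S e d = 0 \<Longrightarrow> d = 0"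
    and ker2: "\<And>d. d + S a d + S a d = 0 \<Longrightarrow> S e d = 0 \<Longrightarrow> d = 0"
  shows "inj (\<lambda>x. - x - S a x + S e x - S a x * S e x ^ (q - 1) + c)"
proof (rule injI)
  have add: "(x + y) ^ (q ^ i) = x ^ (q ^ i) + y ^ (q ^ i)" for x y :: 'k and i
    by (rule freshmans_dream'[where n = "s * i"]) (simp_all add: q power_mult)
  have S_add: "S b (x + y) = S b x + S b y" for b x y
    by (simp add: S_def add sum.distrib)
  have S_diff: "S b (x - y) = S b x - S b y" for b x y
    using S_add[of b "x - y" y] by simp
  have S_2: "S b (2 * x) = 2 * S b x" for b x using S_add[of b x x] by simp
  have S_0: "S b 0 = 0" for b using S_diff[of b 0 0] by simp
  have S_minus: "S b (- x) = - S b x" for b x using S_diff[of b 0 x] S_0 by simp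
  have S_frob: "S b x ^ q = S b (x ^ q)" for b x
    unfolding S_def
    by (subst freshmans_dream_sum'[where n = s]) (simp_all add: q mult.commute flip: power_mult)
  \<comment> \<open>Raising to the power \<open>q\<close> shifts the summands cyclically, as x^(q^e)
    = x.\<close>
  have T_frob: "S e (x ^ q) = S e x" for x
  proof -
    have "S e (x ^ q) + x = (\<Sum>i<e. x ^ (q ^ Suc i)) + x ^ (q ^ 0)"
      by (simp add: S_def flip: power_mult)
    also have "\<dots> = (\<Sum>i<Suc e. x ^ (q ^ i))"
      by (subst sum.lessThan_Suc_shift) simp
    also have "\<dots> = S e x + x"
      using finite_field_power_card_eq_same[of x] by (simp add: S_def card)
    finally show ?thesis by simp
  qed
  have T_frob_pow: "S e (x ^ (q ^ i)) = S e x" for x i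
  proof (induction i)
    case (Suc i)
    have "x ^ (q ^ Suc i) = (x ^ (q ^ i)) ^ q" by (simp add: mult.commute flip: power_mult)
    thus ?case by (simp only: T_frob Suc.IH)
  qed auto
  have T_S: "S e (S b x) = of_nat b * S e x" for b x
  proof (induction b)
    case 0
    show ?case using S_0 by (simp add: S_def)
  next
    case (Suc b)
    have "S (Suc b) x = S b x + x ^ (q ^ b)" by (simp add: S_def)
    thus ?case by (simp add: S_add Suc.IH T_frob_pow algebra_simps)
  qed
  have T_power: "S e x ^ (q - 1) = 1" if "S e x \<noteq> 0" for x
  proof -
    have "S e x * S e x ^ (q - 1) = S e x ^ q"
      using q(2) by (simp flip: power_Suc)
    also have "\<dots> = S e x * 1" by (simp add: S_frob T_frob)
    finally show ?thesis using that mult_left_cancel by blast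
  qed
  \<comment> \<open>The power of the trace is 0 or 1, which leaves two additive pieces.\<close>
  define f where "f x = (if S e x = 0 then - x - S a x else - x - S a x - S a x + S e x)" for x
  have f: "- x - S a x + S e x - S a x * S e x ^ (q - 1) + c = f x + c" for x
    using T_power[of x] q(2) by (auto simp: f_def)
  \<comment> \<open>Off the kernel this uses Tr(S_a(x)) = a Tr(x) and Tr(Tr(x)) = e Tr(x); on it
    both sides are 0.\<close>
  have T_f: "S e (f x) = of_int (- 2 * int a - 1 + int e) * S e x" for x
    by (auto simp: f_def S_add S_diff S_minus S_2 T_S algebra_simps)
  fix x y
  assume "- x - S a x + S e x - S a x * S e x ^ (q - 1) + c =
          - y - S a y + S e y - S a y * S e y ^ (q - 1) + c"
  hence eq: "f x = f y" by (simp only: f add_right_cancel)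
  \<comment> \<open>Equal traces put \<open>x\<close> and \<open>y\<close> on the same piece, and
    \<open>x - y\<close> in the kernel of the trace.\<close>
  hence T: "S e x = S e y" using T_f[of x] T_f[of y] nz by simp
  hence T0: "S e (x - y) = 0" by (simp add: S_diff)
  have "x - y = 0"
  proof (cases "S e x = 0")
    case True
    hence "- x - S a x = - y - S a y" using eq T by (simp add: f_def)
    hence "(x - y) + S a (x - y) = 0" unfolding S_diff by (simp add: algebra_simps)
    thus ?thesis using T0 by (rule ker1)
  next
    case False
    hence "- x - S a x - S a x = - y - S a y - S a y" using eq T by (simp add: f_def)
    hence "(x - y) + S a (x - y) + S a (x - y) = 0" unfolding S_diff by (simp add: algebra_simps)
    thus ?thesis using T0 by (rule ker2)
  qed
  thus "x = y" by simp
qed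

lemma poly_closed_form:
  "poly (closed_form q e a) = (\<lambda>x.
     - x - (\<Sum>i<a. x ^ (q ^ i)) + (\<Sum>i<e. x ^ (q ^ i))
       - (\<Sum>i<a. x ^ (q ^ i)) * (\<Sum>i<e. x ^ (q ^ i)) ^ (q - 1) + (if q = 2 then -1 else 0))"
  by (rule ext) (simp add: closed_form_def S_poly_def Tr_poly_def poly_sum poly_monom)

theorem theorem6p8:
  fixes p q s e a n :: nat
  assumes "CARD('p::prime_card) = p"
    and "q = p ^ s" and "s > 0" and "e > 0" and "a > 0"
    and "CARD('q::finite_field) = q"
    and "CARD('k::finite_field) = q ^ e"
    and "n = (q - 1) * q ^ 0 + (q - 1) * q ^ e + q ^ a"
  shows "(q \<noteq> 2 \<longrightarrow>
            (g_poly TYPE('q) n :: 'p mod_ring poly) =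
              - monom 1 1 - S_poly q a + Tr_poly q e - S_poly q a * Tr_poly q e ^ (q - 1)) \<and>
         (\<not> [- 2 * int a - 1 + int e = 0] (mod int p) \<and>
          gcd (monom 1 a + monom 1 1 - 2) (monom 1 e - 1) = (monom 1 1 - 1 :: 'p mod_ring poly) \<and>
          gcd (2 * monom 1 a + monom 1 1 - 3) (monom 1 e - 1) = (monom 1 1 - 1 :: 'p mod_ring poly)
          \<longrightarrow> permutation_poly (base_change (g_poly TYPE('q) n :: 'p mod_ring poly) :: 'k poly))"
proof -
  note p = assms(1) and Q = assms(6)
  have qs: "q = CARD('p) ^ s" using assms(2) p by simp
  have q1: "q > 1" using CARD_finite_field_gt_1[where ?'q = 'q] Q by simp
  have g: "(g_poly TYPE('q) n :: 'p mod_ring poly) = closed_form q e a"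
    by (rule g_poly_eq_closed_form[OF Q qs assms(8)])
  have CHAR: "CHAR('k) = CARD('p)"
    by (rule CHAR_eq_of_CARD[where s = "s * e"]) (simp add: assms(7) qs power_mult)
  have closed: "q \<noteq> 2 \<longrightarrow> (g_poly TYPE('q) n :: 'p mod_ring poly) =
      - monom 1 1 - S_poly q a + Tr_poly q e - S_poly q a * Tr_poly q e ^ (q - 1)"
    by (simp add: g closed_form_def)
  have perm: "permutation_poly (base_change (g_poly TYPE('q) n :: 'p mod_ring poly) :: 'k poly)"
    if i: "\<not> [- 2 * int a - 1 + int e = 0] (mod int p)"
      and ii: "gcd (monom 1 a + monom 1 1 - 2) (monom 1 e - 1) = (monom 1 1 - 1 :: 'p mod_ring poly)"
      and iii: "gcd (2 * monom 1 a + monom 1 1 - 3) (monom 1 e - 1) = (monom 1 1 - 1 :: 'p mod_ring poly)"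
  proof -
    have nz: "of_int (- 2 * int a - 1 + int e) \<noteq> (0 :: 'k)"
      using i unfolding of_int_eq_0_iff_char_dvd cong_0_iff CHAR p .
    have qc: "q = CHAR('k) ^ s" by (simp only: qs CHAR)
    have "inj (poly (closed_form q e a :: 'k poly))"
      unfolding poly_closed_form
      by (rule inj_trace_form[OF assms(7) qc q1 nz frob_kernel_trivial[OF CHAR qs ii]
            frob_kernel_trivial_double[OF CHAR qs iii]])
    thus ?thesis
      unfolding permutation_poly_def g base_change_closed_form[OF CHAR] bij_def
      using finite_UNIV_inj_surj[OF finite] by blast
  qed
  show ?thesis using closed perm by blast
qed

end
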